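(* Let $U$ be a catalysis unitary on $\mathcal{H}_A\otimes\mathcal{H}_B$ compatible with a catalyst $\sigma$, where $\sigma=\sum_i\lambda_i\Pi_i$ is the eigenspace decomposition of $\sigma$. Then $U$ is also compatible with the normalized projector $\Pi_i/\mathrm{Tr}\,\Pi_i$ onto each eigenspace of $\sigma$. Furthermore, every catalysis unitary on $\mathcal{H}_A\otimes\mathcal{H}_B$ is compatible with the maximally mixed catalyst $\mathbb{1}_B/\dim\mathcal{H}_B$.
   Context: All Hilbert spaces are finite-dimensional. A unitary $U$ on $\mathcal{H}_A\otimes\mathcal{H}_B$ is compatible with a quantum state $\sigma_B$ on $B$ (the catalyst) if there is a unitary $V$ on $\mathcal{H}_B$ such that $\mathrm{Tr}_A\,U(\rho_A\otimes\sigma_B)U^\dagger=V\sigma_BV^\dagger$ for all states $\rho$ on $A$. $U$ is a catalysis unitary if it is compatible with some quantum state. In the eigenspace decomposition $\sigma=\sum_i\lambda_i\Pi_i$ the $\lambda_i$ are the distinct eigenvalues and $\Pi_i$ is the orthogonal projector onto the eigenspace of $\lambda_i$.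
   Formalization: The statement fails for rank-deficient catalysts (identity on A⊗|0>, swap on A⊗K, catalyst |0><0|); proved here for eigenspaces of nonzero eigenvalues of σ, and, for the maximally mixed catalyst, for unitaries compatible with some full-rank state. *)

theory Defs
  imports "HOL-Analysis.Analysis"
begin

text \<open>
  Hilbert spaces are \<^typ>\<open>complex ^ 'a\<close> and \<^typ>\<open>complex ^ 'b\<close> for arbitrary nonempty finite index
  types, i.e. an orthonormal basis is fixed on each factor; the tensor product has the product
  basis, indexed by \<^typ>\<open>'a \<times> 'b\<close>. Operators are square matrices.
\<close>

definition dagger :: "complex ^ 'n ^ 'm \<Rightarrow> complex ^ 'm ^ 'n" where
  "dagger A = (\<chi> i j. cnj (A $ j $ i))"

text \<open>The library operation \<open>*s\<close> scales vectors, not matrices.\<close>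

definition cscale :: "complex \<Rightarrow> complex ^ 'n ^ 'm \<Rightarrow> complex ^ 'n ^ 'm"  (infixr "*\<^sub>C" 75) where
  "c *\<^sub>C A = (\<chi> i j. c * A $ i $ j)"

definition unitary :: "complex ^ 'n ^ 'n \<Rightarrow> bool" where
  "unitary U \<longleftrightarrow> dagger U ** U = mat 1 \<and> U ** dagger U = mat 1"

definition hermitian :: "complex ^ 'n ^ 'n \<Rightarrow> bool" where
  "hermitian A \<longleftrightarrow> dagger A = A"

definition density_operator :: "complex ^ 'n ^ 'n \<Rightarrow> bool" where
  "density_operator \<rho> \<longleftrightarrow>
     hermitian \<rho> \<and>
     (\<forall>v. 0 \<le> Re (\<Sum>i\<in>UNIV. cnj (v $ i) * (\<rho> *v v) $ i)) \<and>
     trace \<rho> = 1"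

definition tensor_op ::
  "complex ^ 'a ^ 'a \<Rightarrow> complex ^ 'b ^ 'b \<Rightarrow> complex ^ ('a \<times> 'b) ^ ('a \<times> 'b)"  (infixr "\<otimes>\<^sub>o" 75) where
  "A \<otimes>\<^sub>o B = (\<chi> p q. A $ fst p $ fst q * B $ snd p $ snd q)"

definition partial_trace_A ::
  "complex ^ ('a::finite \<times> 'b::finite) ^ ('a \<times> 'b) \<Rightarrow> complex ^ 'b ^ 'b" where
  "partial_trace_A M = (\<chi> i j. \<Sum>a\<in>UNIV. M $ (a, i) $ (a, j))"

text \<open>The unitary \<open>V\<close> is chosen before, hence independently of, the input state \<open>\<rho>\<close>.\<close>

definition compatible ::
  "complex ^ ('a::finite \<times> 'b::finite) ^ ('a \<times> 'b) \<Rightarrow> complex ^ 'b ^ 'b \<Rightarrow> bool" where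
  "compatible U \<sigma> \<longleftrightarrow>
     unitary U \<and> density_operator \<sigma> \<and>
     (\<exists>V. unitary V \<and>
       (\<forall>\<rho> :: complex ^ 'a ^ 'a. density_operator \<rho> \<longrightarrow>
          partial_trace_A (U ** (\<rho> \<otimes>\<^sub>o \<sigma>) ** dagger U) = V ** \<sigma> ** dagger V))"

definition eigenspace :: "complex ^ 'n ^ 'n \<Rightarrow> complex \<Rightarrow> (complex ^ 'n) set" where
  "eigenspace A l = {v. A *v v = l *s v}"

definition eigenvalues :: "complex ^ 'n ^ 'n \<Rightarrow> complex set" where
  "eigenvalues A = {l. \<exists>v. v \<noteq> 0 \<and> v \<in> eigenspace A l}"

definition is_orthogonal_projector_onto :: "complex ^ 'n ^ 'n \<Rightarrow> (complex ^ 'n) set \<Rightarrow> bool" where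
  "is_orthogonal_projector_onto P S \<longleftrightarrow> hermitian P \<and> P ** P = P \<and> range ((*v) P) = S"

text \<open>
  The projectors are indexed by the distinct eigenvalues themselves; values of \<open>P\<close> outside
  \<^term>\<open>eigenvalues \<sigma>\<close> are irrelevant.
\<close>

definition eigenspace_decomposition ::
  "complex ^ 'n ^ 'n \<Rightarrow> (complex \<Rightarrow> complex ^ 'n ^ 'n) \<Rightarrow> bool" where
  "eigenspace_decomposition \<sigma> P \<longleftrightarrow>
     (\<forall>l \<in> eigenvalues \<sigma>. is_orthogonal_projector_onto (P l) (eigenspace \<sigma> l)) \<and>
     \<sigma> = (\<Sum>l \<in> eigenvalues \<sigma>. l *\<^sub>C P l)"

definition normalized :: "complex ^ 'n ^ 'n \<Rightarrow> complex ^ 'n ^ 'n" where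
  "normalized P = (1 / trace P) *\<^sub>C P"

definition maximally_mixed :: "complex ^ 'n ^ 'n" where
  "maximally_mixed = (1 / of_nat CARD('n)) *\<^sub>C mat 1"

text \<open>
  A catalyst may be rank-deficient, and then its kernel has to be excluded: for \<open>\<H>\<^sub>A\<close> of dimension 2 and
  \<open>\<H>\<^sub>B\<close> of dimension \<open>1 + 2\<close>, the identity on \<open>\<H>\<^sub>A \<otimes> |0>\<close> plus the swap on the rest is a
  unitary compatible with the pure state \<open>|0><0|\<close>, but neither with the normalized projector onto
  the kernel of that state nor with the maximally mixed state. So the eigenspaces considered are
  those of nonzero eigenvalues (all of them if \<open>\<sigma>\<close> has full rank), and the claim about the
  maximally mixed state is for unitaries that admit a catalyst of full rank, i.e. an invertible one.
\<close>

end

theory Submission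
  imports Defs
begin

text \<open>
  The Hilbert-Schmidt norm of \<open>U (1 \<otimes> \<sigma>) U\<^sup>\<dagger> - 1 \<otimes> V \<sigma> V\<^sup>\<dagger>\<close> vanishes, because both operators are
  unitarily equivalent to \<open>1 \<otimes> \<sigma>\<close> and have the same partial trace. Hence \<open>U\<close> intertwines \<open>1 \<otimes> \<sigma>\<close>
  with \<open>1 \<otimes> V \<sigma> V\<^sup>\<dagger>\<close>, and therefore also the spectral projectors for nonzero eigenvalues and, if
  \<open>\<sigma>\<close> is invertible, the inverses. Multiplying the compatibility equation for \<open>\<sigma>\<close> by such an
  operator on \<open>B\<close> gives the compatibility equations for the projectors and for the identity.
\<close>

section \<open>Adjoints, scalar multiples, traces and unitary conjugation\<close>

lemma dagger_mult: "dagger (A ** B) = dagger B ** dagger A"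
  by (simp add: dagger_def matrix_matrix_mult_def vec_eq_iff mult.commute)

lemma dagger_dagger [simp]: "dagger (dagger A) = A"
  by (simp add: dagger_def vec_eq_iff)

lemma dagger_mat_1 [simp]: "dagger (mat 1) = mat 1"
  by (auto simp: dagger_def mat_def vec_eq_iff)

lemma dagger_diff: "dagger (A - B) = dagger A - dagger B"
  by (simp add: dagger_def vec_eq_iff)

lemma dagger_cscale: "dagger (c *\<^sub>C A) = cnj c *\<^sub>C dagger A"
  by (simp add: dagger_def cscale_def vec_eq_iff)

lemma cscale_mult_left: "(c *\<^sub>C A) ** B = c *\<^sub>C (A ** B)"
  by (simp add: cscale_def matrix_matrix_mult_def vec_eq_iff sum_distrib_left mult.assoc)

lemma cscale_mult_right: "A ** (c *\<^sub>C B) = c *\<^sub>C (A ** B)"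
  by (simp add: cscale_def matrix_matrix_mult_def vec_eq_iff sum_distrib_left mult.left_commute)

lemma cscale_cscale [simp]: "c *\<^sub>C d *\<^sub>C A = (c * d) *\<^sub>C A"
  by (simp add: cscale_def vec_eq_iff)

lemma cscale_1 [simp]: "1 *\<^sub>C A = A"
  by (simp add: cscale_def vec_eq_iff)

lemma cscale_eq_cscale_iff: "c *\<^sub>C A = d *\<^sub>C A \<longleftrightarrow> c = d \<or> A = 0"
  by (auto simp: cscale_def vec_eq_iff)

lemma cscale_left_cancel: "c \<noteq> 0 \<Longrightarrow> c *\<^sub>C A = c *\<^sub>C B \<longleftrightarrow> A = B"
  by (auto simp: cscale_def vec_eq_iff)

lemma matrix_mult_sum_left: "(\<Sum>i\<in>I. F i) ** B = (\<Sum>i\<in>I. F i ** B)"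
  for B :: "complex ^ 'n ^ 'm"
  by (simp add: matrix_matrix_mult_def vec_eq_iff sum_distrib_right sum.swap[where A = I])

lemma matrix_mult_sum_right: "A ** (\<Sum>i\<in>I. F i) = (\<Sum>i\<in>I. A ** F i)"
  for A :: "complex ^ 'n ^ 'm"
  by (simp add: matrix_matrix_mult_def vec_eq_iff sum_distrib_left sum.swap[where A = I])

lemma matrix_mult_diff_left: "(A - B) ** C = A ** C - B ** C"
  for A :: "complex ^ 'n ^ 'm"
  by (simp add: matrix_matrix_mult_def vec_eq_iff left_diff_distrib sum_subtractf)

lemma matrix_mult_diff_right: "A ** (B - C) = A ** B - A ** C"
  for A :: "complex ^ 'n ^ 'm"
  by (simp add: matrix_matrix_mult_def vec_eq_iff right_diff_distrib sum_subtractf)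

lemma trace_cscale: "trace (c *\<^sub>C A) = c * trace A"
  by (simp add: trace_def cscale_def sum_distrib_left)

lemma trace_dagger_mult: "trace (dagger A ** A) = of_real (\<Sum>i\<in>UNIV. \<Sum>j\<in>UNIV. (cmod (A $ j $ i))\<^sup>2)"
  by (simp add: trace_def dagger_def matrix_matrix_mult_def complex_norm_square mult.commute del: of_real_power)

text \<open>The trace is the squared Hilbert-Schmidt norm of \<open>A\<close>, a sum of squared
  moduli of entries. This turns identities between traces into identities between operators.\<close>

lemma trace_dagger_mult_eq_0_iff: "trace (dagger A ** A) = 0 \<longleftrightarrow> A = 0"
  by (simp only: trace_dagger_mult of_real_eq_0_iff)
    (auto simp: sum_nonneg_eq_0_iff sum_nonneg vec_eq_iff)

lemma trace_unitary_conj: "unitary W \<Longrightarrow> trace (W ** X ** dagger W) = trace X"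
  by (metis matrix_mul_assoc matrix_mul_lid trace_mul_sym unitary_def)

lemma unitary_conj_mult:
  assumes "unitary W"
  shows "(W ** X ** dagger W) ** (W ** Y ** dagger W) = W ** (X ** Y) ** dagger W"
proof -
  have "(W ** X ** dagger W) ** (W ** Y ** dagger W) = W ** X ** (dagger W ** W) ** Y ** dagger W"
    by (simp only: matrix_mul_assoc)
  with assms show ?thesis
    by (simp add: unitary_def matrix_mul_assoc)
qed

lemma unitary_conj_mult_left:
  assumes "unitary W"
  shows "(W ** X ** dagger W) ** W = W ** X"
  using assms by (metis matrix_mul_assoc matrix_mul_rid unitary_def)

lemma hermitian_conj: "hermitian X \<Longrightarrow> hermitian (W ** X ** dagger W)"
  by (simp add: hermitian_def dagger_mult matrix_mul_assoc)

section \<open>Tensor products and the partial trace\<close>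

lemma tensor_op_mult: "(A \<otimes>\<^sub>o B) ** (C \<otimes>\<^sub>o D) = (A ** C) \<otimes>\<^sub>o (B ** D)"
  unfolding tensor_op_def matrix_matrix_mult_def vec_eq_iff
  by (simp add: sum_product sum.cartesian_product UNIV_Times_UNIV[symmetric] case_prod_unfold
      mult_ac del: UNIV_Times_UNIV)

lemma tensor_op_mat_1: "mat 1 \<otimes>\<^sub>o mat 1 = mat 1"
  by (auto simp: tensor_op_def mat_def vec_eq_iff prod_eq_iff)

lemma dagger_tensor_op: "dagger (A \<otimes>\<^sub>o B) = dagger A \<otimes>\<^sub>o dagger B"
  by (simp add: tensor_op_def dagger_def vec_eq_iff)

lemma tensor_op_cscale_left: "(c *\<^sub>C A) \<otimes>\<^sub>o B = c *\<^sub>C (A \<otimes>\<^sub>o B)"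
  by (simp add: tensor_op_def cscale_def vec_eq_iff mult.assoc)

lemma tensor_op_cscale_right: "A \<otimes>\<^sub>o (c *\<^sub>C B) = c *\<^sub>C (A \<otimes>\<^sub>o B)"
  by (simp add: tensor_op_def cscale_def vec_eq_iff mult.left_commute)

lemma tensor_op_sum_right: "A \<otimes>\<^sub>o (\<Sum>i\<in>I. F i) = (\<Sum>i\<in>I. A \<otimes>\<^sub>o F i)"
  by (simp add: tensor_op_def vec_eq_iff sum_distrib_left)

lemma unitary_mat_1_tensor_op: "unitary V \<Longrightarrow> unitary (mat 1 \<otimes>\<^sub>o V)"
  by (simp add: unitary_def dagger_tensor_op tensor_op_mult tensor_op_mat_1)

lemma partial_trace_cscale: "partial_trace_A (c *\<^sub>C M) = c *\<^sub>C partial_trace_A M"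
  by (simp add: partial_trace_A_def cscale_def vec_eq_iff sum_distrib_left)

text \<open>The factor \<open>mat 1\<close> is diagonal in the index on A, so \<open>B\<close> comes
  out of the sum over that index. This is how an operator on B is applied to the compatibility
  equation.\<close>

lemma partial_trace_mat_1_tensor_op_mult:
  "partial_trace_A ((mat 1 \<otimes>\<^sub>o B) ** M) = B ** partial_trace_A M"
proof -
  have "(\<Sum>a\<in>UNIV. \<Sum>q\<in>UNIV. mat 1 $ a $ fst q * B $ i $ snd q * M $ q $ (a, j))
      = (\<Sum>k\<in>UNIV. B $ i $ k * (\<Sum>a\<in>UNIV. M $ (a, k) $ (a, j)))" for i j
  proof -
    have "(\<Sum>q\<in>UNIV. mat 1 $ a $ fst q * B $ i $ snd q * M $ q $ (a, j))
        = (\<Sum>k\<in>UNIV. B $ i $ k * M $ (a, k) $ (a, j))" for a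
    proof -
      have "(\<Sum>q\<in>UNIV. mat 1 $ a $ fst q * B $ i $ snd q * M $ q $ (a, j))
          = (\<Sum>b\<in>UNIV. \<Sum>k\<in>UNIV. mat 1 $ a $ b * B $ i $ k * M $ (b, k) $ (a, j))"
        by (simp add: sum.cartesian_product case_prod_unfold)
      also have "\<dots> = (\<Sum>b\<in>UNIV. if a = b then \<Sum>k\<in>UNIV. B $ i $ k * M $ (b, k) $ (a, j) else 0)"
        by (intro sum.cong) (auto simp: mat_def)
      finally show ?thesis
        by simp
    qed
    then show ?thesis
      by (simp add: sum_distrib_left sum.swap[of _ "UNIV :: 'b set"])
  qed
  then show ?thesis
    by (simp add: partial_trace_A_def tensor_op_def matrix_matrix_mult_def vec_eq_iff)
qed

lemma partial_trace_mat_1_tensor_op: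
  "partial_trace_A ((mat 1 :: complex ^ 'a ^ 'a) \<otimes>\<^sub>o B) = of_nat CARD('a::finite) *\<^sub>C B"
  by (simp add: partial_trace_A_def tensor_op_def cscale_def mat_def vec_eq_iff)

lemma trace_partial_trace: "trace (partial_trace_A M) = trace M"
proof -
  have "trace M = (\<Sum>a\<in>UNIV. \<Sum>b\<in>UNIV. M $ (a, b) $ (a, b))"
    by (simp add: trace_def sum.cartesian_product case_prod_unfold)
  then show ?thesis
    by (simp add: trace_def partial_trace_A_def sum.swap[of _ "UNIV :: 'a set"])
qed

section \<open>Projectors and the states obtained from them\<close>

lemma projector_expectation:
  assumes "hermitian P" "P ** P = P"
  shows "(\<Sum>i\<in>UNIV. cnj (v $ i) * (P *v v) $ i) = of_real (\<Sum>i\<in>UNIV. (cmod ((P *v v) $ i))\<^sup>2)"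
proof -
  have adj: "cnj (P $ i $ j) = P $ j $ i" for i j
    using assms(1) by (auto simp: hermitian_def dagger_def vec_eq_iff)
  \<comment> \<open>Stated for general \<open>w\<close> so that it can be used at
    \<open>w = P *v v\<close>, where idempotence turns the left side into the expectation of
    \<open>P\<close> in \<open>v\<close> and the right side into the squared norm of
    \<open>P *v v\<close>.\<close>
  have adjoint: "(\<Sum>i\<in>UNIV. cnj (v $ i) * (P *v w) $ i) = (\<Sum>i\<in>UNIV. cnj ((P *v v) $ i) * w $ i)" for w
  proof -
    have "(\<Sum>i\<in>UNIV. cnj (v $ i) * (P *v w) $ i)
        = (\<Sum>i\<in>UNIV. \<Sum>j\<in>UNIV. cnj (v $ i) * (P $ i $ j * w $ j))"
      by (simp add: matrix_vector_mult_def sum_distrib_left)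
    also have "\<dots> = (\<Sum>j\<in>UNIV. \<Sum>i\<in>UNIV. cnj (v $ i) * (P $ i $ j * w $ j))"
      by (rule sum.swap)
    also have "\<dots> = (\<Sum>j\<in>UNIV. cnj ((P *v v) $ j) * w $ j)"
      by (simp add: matrix_vector_mult_def sum_distrib_left adj mult_ac)
    finally show ?thesis .
  qed
  have "P *v (P *v v) = P *v v"
    by (simp add: matrix_vector_mul_assoc assms(2))
  with adjoint[of "P *v v"] show ?thesis
    by (simp add: complex_norm_square mult.commute del: of_real_power)
qed

lemma density_operator_normalized_projector:
  assumes P: "hermitian P" "P ** P = P" and "P \<noteq> 0"
  shows "density_operator (normalized P)"
proof -
  \<comment> \<open>The squared Hilbert-Schmidt norm of \<open>P\<close>. As
    \<open>P = dagger P ** P\<close>, it equals the trace, which is therefore real, nonnegative, and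
    nonzero because \<open>P \<noteq> 0\<close>.\<close>
  define t where "t = (\<Sum>i\<in>UNIV. \<Sum>j\<in>UNIV. (cmod (P $ j $ i))\<^sup>2)"
  have tr: "trace P = of_real t"
    using trace_dagger_mult[of P] P by (simp add: t_def hermitian_def)
  have "trace P \<noteq> 0"
    using trace_dagger_mult_eq_0_iff[of P] assms by (simp add: hermitian_def)
  have "t \<ge> 0"
    by (simp add: t_def sum_nonneg)
  have exp: "(\<Sum>i\<in>UNIV. cnj (v $ i) * (normalized P *v v) $ i)
      = of_real (1 / t * (\<Sum>i\<in>UNIV. (cmod ((P *v v) $ i))\<^sup>2))" for v
  proof -
    have "(\<Sum>i\<in>UNIV. cnj (v $ i) * (normalized P *v v) $ i)
        = 1 / trace P * (\<Sum>i\<in>UNIV. cnj (v $ i) * (P *v v) $ i)"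
      by (simp add: normalized_def cscale_def matrix_vector_mult_def sum_distrib_left mult_ac)
    then show ?thesis
      by (simp add: projector_expectation[OF P] tr)
  qed
  have "0 \<le> Re (\<Sum>i\<in>UNIV. cnj (v $ i) * (normalized P *v v) $ i)" for v
    unfolding exp Re_complex_of_real using \<open>t \<ge> 0\<close> by (simp add: sum_nonneg)
  moreover have "hermitian (normalized P)"
    using P tr by (simp add: hermitian_def normalized_def dagger_cscale)
  ultimately show ?thesis
    using \<open>trace P \<noteq> 0\<close> by (simp add: density_operator_def normalized_def trace_cscale)
qed

text \<open>The identity projects onto the whole space, so results on normalized projectors cover
  the maximally mixed state.\<close>

lemma maximally_mixed_eq: "maximally_mixed = normalized (mat 1)"
  by (simp add: maximally_mixed_def normalized_def trace_def mat_def)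

lemma density_operator_maximally_mixed: "density_operator maximally_mixed"
proof -
  have "(mat 1 :: complex ^ 'n ^ 'n) \<noteq> 0"
    by (auto simp: mat_def vec_eq_iff)
  then show ?thesis
    unfolding maximally_mixed_eq
    by (intro density_operator_normalized_projector) (auto simp: hermitian_def)
qed

section \<open>Trace criterion for equality, and intertwining of spectral components\<close>

lemma hermitian_eqI:
  assumes "hermitian S" "hermitian T"
    and "trace (S ** S) = trace (T ** T)" "trace (T ** S) = trace (T ** T)"
  shows "S = T"
proof -
  have "trace (dagger (S - T) ** (S - T)) = trace (S ** S) - trace (S ** T) - (trace (T ** S) - trace (T ** T))"
    using assms(1,2)
    by (simp add: dagger_diff hermitian_def matrix_mult_diff_left matrix_mult_diff_right trace_sub)
  also have "\<dots> = 0"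
    using assms(3,4) by (simp add: trace_mul_sym[of S T])
  finally show ?thesis
    using trace_dagger_mult_eq_0_iff[of "S - T"] by simp
qed

text \<open>The blocks of \<open>X\<close> between components of different eigenvalues vanish. Hence
  \<open>B ** X ** P l\<close> and \<open>Q l ** X ** A\<close> both reduce to \<open>l\<close>
  times the diagonal block \<open>Q l ** X ** P l\<close>; they are also \<open>l\<close> times the
  two sides of the claim, and \<open>l \<noteq> 0\<close> allows the cancellation.\<close>

lemma intertwines_spectral_component:
  fixes P Q :: "complex \<Rightarrow> complex ^ 'n ^ 'n"
  assumes E: "finite E" and l: "l \<in> E" "l \<noteq> 0"
    and A: "A = (\<Sum>m\<in>E. m *\<^sub>C P m)" "\<And>m. m \<in> E \<Longrightarrow> A ** P m = m *\<^sub>C P m"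
    and B: "B = (\<Sum>m\<in>E. m *\<^sub>C Q m)" "\<And>m. m \<in> E \<Longrightarrow> Q m ** B = m *\<^sub>C Q m"
    and X: "X ** A = B ** X"
  shows "X ** P l = Q l ** X"
proof -
  \<comment> \<open>Moving from \<open>B\<close> to \<open>A\<close> through
    \<open>X ** A = B ** X\<close> shows that \<open>m\<close> times and \<open>n\<close> times the
    block agree.\<close>
  have off: "Q m ** X ** P n = 0" if "m \<in> E" "n \<in> E" "m \<noteq> n" for m n
  proof -
    have "m *\<^sub>C (Q m ** X ** P n) = Q m ** B ** X ** P n"
      by (simp add: B(2) that cscale_mult_left)
    also have "\<dots> = Q m ** X ** (A ** P n)"
      using X by (metis matrix_mul_assoc)
    also have "\<dots> = n *\<^sub>C (Q m ** X ** P n)"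
      by (simp add: A(2) that cscale_mult_right)
    finally show ?thesis
      using that(3) by (simp add: cscale_eq_cscale_iff)
  qed
  \<comment> \<open>Used for the expansion of \<open>B\<close> with \<open>P l\<close> fixed and for
    the expansion of \<open>A\<close> with \<open>Q l\<close> fixed.\<close>
  have single: "(\<Sum>m\<in>E. m *\<^sub>C F m) = l *\<^sub>C F l" if "\<And>m. m \<in> E \<Longrightarrow> m \<noteq> l \<Longrightarrow> F m = 0"
    for F :: "complex \<Rightarrow> complex ^ 'n ^ 'n"
  proof -
    have "(\<Sum>m\<in>E. m *\<^sub>C F m) = (\<Sum>m\<in>{l}. m *\<^sub>C F m)"
      using E l that by (intro sum.mono_neutral_right) (auto simp: cscale_def vec_eq_iff)
    then show ?thesis
      by simp
  qed
  have "l *\<^sub>C (X ** P l) = X ** (A ** P l)"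
    by (simp add: A(2) l cscale_mult_right)
  also have "\<dots> = B ** X ** P l"
    using X by (simp add: matrix_mul_assoc)
  also have "\<dots> = (\<Sum>m\<in>E. m *\<^sub>C (Q m ** X ** P l))"
    by (simp add: B(1) matrix_mult_sum_left cscale_mult_left)
  also have "\<dots> = l *\<^sub>C (Q l ** X ** P l)"
    using off l by (intro single) auto
  also have "\<dots> = (\<Sum>m\<in>E. m *\<^sub>C (Q l ** X ** P m))"
    using off l by (intro single[symmetric]) auto
  also have "\<dots> = Q l ** X ** A"
    by (simp add: A(1) matrix_mult_sum_right cscale_mult_right)
  also have "\<dots> = Q l ** B ** X"
    using X by (metis matrix_mul_assoc)
  also have "\<dots> = l *\<^sub>C (Q l ** X)"
    by (simp add: B(2) l cscale_mult_left)
  finally show ?thesis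
    by (simp add: cscale_left_cancel[OF l(2)])
qed

text \<open>The range of \<open>P l\<close> consists of solutions of the eigenvalue equation, which
  gives the product with \<sigma> on the left; the other product follows by taking adjoints.\<close>

lemma eigenprojector_properties:
  assumes \<sigma>: "hermitian \<sigma>" and dec: "eigenspace_decomposition \<sigma> P" and l: "l \<in> eigenvalues \<sigma>"
  shows "hermitian (P l)" "P l ** P l = P l" "P l \<noteq> 0" "\<sigma> ** P l = l *\<^sub>C P l" "P l ** \<sigma> = l *\<^sub>C P l"
proof -
  have proj: "is_orthogonal_projector_onto (P l) (eigenspace \<sigma> l)"
    using dec l by (auto simp: eigenspace_decomposition_def)
  then show herm: "hermitian (P l)" and idem: "P l ** P l = P l"
    by (auto simp: is_orthogonal_projector_onto_def)
  obtain v where "v \<noteq> 0" "v \<in> range ((*v) (P l))"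
    using l proj by (auto simp: eigenvalues_def is_orthogonal_projector_onto_def)
  then show "P l \<noteq> 0"
    by auto
  have "\<sigma> *v (P l *v w) = l *s (P l *v w)" for w
    using proj by (auto simp: is_orthogonal_projector_onto_def eigenspace_def)
  then have "(\<sigma> ** P l) *v w = (l *\<^sub>C P l) *v w" for w
    by (simp add: matrix_vector_mul_assoc[symmetric])
      (simp add: cscale_def matrix_vector_mult_def vec_eq_iff sum_distrib_left mult.assoc)
  then show right: "\<sigma> ** P l = l *\<^sub>C P l"
    by (simp add: matrix_eq)
  have "P l ** \<sigma> = dagger (\<sigma> ** P l)"
    using \<sigma> herm by (simp add: dagger_mult hermitian_def)
  also have "\<dots> = cnj l *\<^sub>C P l"
    using herm unfolding right by (simp add: dagger_cscale hermitian_def)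
  finally have left: "P l ** \<sigma> = cnj l *\<^sub>C P l" .
  \<comment> \<open>The adjoint has produced \<open>cnj l\<close> in place of \<open>l\<close>.
    Evaluating the sandwiched product from either side removes the conjugate.\<close>
  have "cnj l *\<^sub>C P l = P l ** \<sigma> ** P l"
    by (simp add: left cscale_mult_left idem)
  also have "\<dots> = l *\<^sub>C P l"
    by (simp add: matrix_mul_assoc[symmetric] right cscale_mult_right idem)
  finally show "P l ** \<sigma> = l *\<^sub>C P l"
    using left by simp
qed

section \<open>Consequences of compatibility, with the witness \<open>V\<close> fixed\<close>

locale catalysis =
  fixes U :: "complex ^ ('a::finite \<times> 'b::finite) ^ ('a \<times> 'b)" and \<sigma> V :: "complex ^ 'b ^ 'b"
  assumes unitary_U: "unitary U" and unitary_V: "unitary V"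
    and density: "density_operator \<sigma>"
    and fixed_output: "\<And>\<rho> :: complex ^ 'a ^ 'a. density_operator \<rho> \<Longrightarrow>
      partial_trace_A (U ** (\<rho> \<otimes>\<^sub>o \<sigma>) ** dagger U) = V ** \<sigma> ** dagger V"
begin

text \<open>Conjugation by \<open>V\<close> is linear and multiplicative, so it carries a spectral
  decomposition of \<sigma> to one of the output state.\<close>

definition rotated :: "complex ^ 'b ^ 'b \<Rightarrow> complex ^ 'b ^ 'b" where
  "rotated X = V ** X ** dagger V"

lemma mat_1_tensor_op_rotated:
  "mat 1 \<otimes>\<^sub>o rotated X = (mat 1 \<otimes>\<^sub>o V) ** (mat 1 \<otimes>\<^sub>o X) ** dagger (mat 1 \<otimes>\<^sub>o V)"
  by (simp add: rotated_def dagger_tensor_op tensor_op_mult)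

lemma intertwines_catalyst: "U ** (mat 1 \<otimes>\<^sub>o \<sigma>) = (mat 1 \<otimes>\<^sub>o rotated \<sigma>) ** U"
proof -
  define X :: "complex ^ ('a \<times> 'b) ^ ('a \<times> 'b)" where "X = mat 1 \<otimes>\<^sub>o \<sigma>"
  define S where "S = U ** X ** dagger U"
  define T :: "complex ^ ('a \<times> 'b) ^ ('a \<times> 'b)" where "T = mat 1 \<otimes>\<^sub>o rotated \<sigma>"
  define W :: "complex ^ ('a \<times> 'b) ^ ('a \<times> 'b)" where "W = mat 1 \<otimes>\<^sub>o V"
  have W: "unitary W" "T = W ** X ** dagger W"
    using unitary_V by (simp_all add: W_def T_def X_def unitary_mat_1_tensor_op mat_1_tensor_op_rotated)
  have "hermitian X"
    using density by (simp add: X_def hermitian_def density_operator_def dagger_tensor_op)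
  \<comment> \<open>The maximally mixed input is the one that puts a multiple of the identity on
    A.\<close>
  have "(1 / of_nat CARD('a)) *\<^sub>C partial_trace_A S = rotated \<sigma>"
    using fixed_output[OF density_operator_maximally_mixed]
    by (simp add: rotated_def S_def X_def maximally_mixed_def tensor_op_cscale_left cscale_mult_left
        cscale_mult_right partial_trace_cscale)
  then have "of_nat CARD('a) *\<^sub>C (1 / of_nat CARD('a)) *\<^sub>C partial_trace_A S = partial_trace_A T"
    by (simp add: T_def partial_trace_mat_1_tensor_op del: cscale_cscale)
  then have "partial_trace_A S = partial_trace_A T"
    by simp
  \<comment> \<open>\<open>T\<close> acts on B only, so the partial trace of \<open>T ** S\<close>
    depends on \<open>S\<close> only through its partial trace.\<close>
  then have "partial_trace_A (T ** S) = partial_trace_A (T ** T)"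
    by (simp add: T_def partial_trace_mat_1_tensor_op_mult)
  then have "trace (T ** S) = trace (T ** T)"
    by (metis trace_partial_trace)
  \<comment> \<open>Both \<open>S\<close> and \<open>T\<close> are unitary conjugates of
    \<open>X\<close>.\<close>
  moreover have "trace (S ** S) = trace (T ** T)"
    using W unitary_U by (simp add: S_def unitary_conj_mult trace_unitary_conj)
  ultimately have "S = T"
    using \<open>hermitian X\<close> W by (intro hermitian_eqI) (simp_all add: S_def hermitian_conj)
  then show ?thesis
    using unitary_conj_mult_left[OF unitary_U, of X] by (simp add: S_def T_def X_def)
qed

text \<open>The factor \<open>B\<close> splits off the input, passes through \<open>U\<close> as
  \<open>rotated B\<close>, leaves the partial trace, and multiplies the known output
  \<open>rotated \<sigma>\<close>.\<close>

lemma intertwined_output: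
  fixes \<rho> :: "complex ^ 'a ^ 'a"
  assumes "U ** (mat 1 \<otimes>\<^sub>o B) = (mat 1 \<otimes>\<^sub>o rotated B) ** U" "density_operator \<rho>"
  shows "partial_trace_A (U ** (\<rho> \<otimes>\<^sub>o (B ** \<sigma>)) ** dagger U) = rotated (B ** \<sigma>)"
proof -
  have "\<rho> \<otimes>\<^sub>o (B ** \<sigma>) = (mat 1 \<otimes>\<^sub>o B) ** (\<rho> \<otimes>\<^sub>o \<sigma>)"
    by (simp add: tensor_op_mult)
  then have "U ** (\<rho> \<otimes>\<^sub>o (B ** \<sigma>)) ** dagger U
      = (mat 1 \<otimes>\<^sub>o rotated B) ** (U ** (\<rho> \<otimes>\<^sub>o \<sigma>) ** dagger U)"
    using assms(1) by (simp add: matrix_mul_assoc)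
  then have "partial_trace_A (U ** (\<rho> \<otimes>\<^sub>o (B ** \<sigma>)) ** dagger U) = rotated B ** rotated \<sigma>"
    using fixed_output[OF assms(2)] by (simp add: partial_trace_mat_1_tensor_op_mult rotated_def)
  then show ?thesis
    by (simp add: rotated_def unitary_conj_mult[OF unitary_V])
qed

text \<open>The common end of both claims: \<open>B\<close> is an eigenprojector with
  \<open>c\<close> its eigenvalue, or the inverse of \<sigma> with \<open>c = 1\<close> and
  \<open>P = mat 1\<close>. The same \<open>V\<close> serves as witness, and \<open>c\<close>
  cancels by linearity.\<close>

lemma compatible_normalized:
  assumes "U ** (mat 1 \<otimes>\<^sub>o B) = (mat 1 \<otimes>\<^sub>o rotated B) ** U"
    and B: "B ** \<sigma> = c *\<^sub>C P" "c \<noteq> 0"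
    and P: "hermitian P" "P ** P = P" "P \<noteq> 0"
  shows "compatible U (normalized P)"
proof -
  have "partial_trace_A (U ** (\<rho> \<otimes>\<^sub>o normalized P) ** dagger U) = V ** normalized P ** dagger V"
    if "density_operator \<rho>" for \<rho>
  proof -
    have "c *\<^sub>C partial_trace_A (U ** (\<rho> \<otimes>\<^sub>o P) ** dagger U) = c *\<^sub>C (V ** P ** dagger V)"
      using intertwined_output[OF assms(1) that]
      by (simp add: B(1) rotated_def tensor_op_cscale_right cscale_mult_left cscale_mult_right
          partial_trace_cscale)
    then show ?thesis
      by (simp add: cscale_left_cancel[OF B(2)] normalized_def tensor_op_cscale_right cscale_mult_left
          cscale_mult_right partial_trace_cscale)
  qed
  then show ?thesis
    using unitary_U unitary_V density_operator_normalized_projector[OF P]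
    by (auto simp: compatible_def)
qed

lemma rotated_mult: "rotated X ** rotated Y = rotated (X ** Y)"
  by (simp add: rotated_def unitary_conj_mult[OF unitary_V])

lemma rotated_cscale: "rotated (c *\<^sub>C X) = c *\<^sub>C rotated X"
  by (simp add: rotated_def cscale_mult_left cscale_mult_right)

lemma rotated_sum: "rotated (\<Sum>i\<in>I. F i) = (\<Sum>i\<in>I. rotated (F i))"
  by (simp add: rotated_def matrix_mult_sum_left matrix_mult_sum_right)

lemma compatible_maximally_mixed:
  assumes "invertible \<sigma>"
  shows "compatible U maximally_mixed"
proof -
  obtain B where B: "\<sigma> ** B = mat 1" "B ** \<sigma> = mat 1"
    using assms by (auto simp: invertible_def)
  have rot_1: "rotated (mat 1) = mat 1"
    using unitary_V by (simp add: rotated_def unitary_def)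
  \<comment> \<open>Insert \<open>\<sigma> ** B = mat 1\<close> on the right. Intertwining then
    brings \<open>rotated \<sigma>\<close> next to \<open>rotated B\<close>, and these two
    cancel.\<close>
  have "(mat 1 \<otimes>\<^sub>o rotated B) ** U = (mat 1 \<otimes>\<^sub>o rotated B) ** (U ** (mat 1 \<otimes>\<^sub>o \<sigma>)) ** (mat 1 \<otimes>\<^sub>o B)"
    by (simp add: matrix_mul_assoc[symmetric] tensor_op_mult B tensor_op_mat_1)
  also have "\<dots> = (mat 1 \<otimes>\<^sub>o (rotated B ** rotated \<sigma>)) ** U ** (mat 1 \<otimes>\<^sub>o B)"
    by (simp add: intertwines_catalyst matrix_mul_assoc tensor_op_mult)
  also have "\<dots> = U ** (mat 1 \<otimes>\<^sub>o B)"
    by (simp add: rotated_mult B rot_1 tensor_op_mat_1)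
  finally have "U ** (mat 1 \<otimes>\<^sub>o B) = (mat 1 \<otimes>\<^sub>o rotated B) ** U" ..
  moreover have "(mat 1 :: complex ^ 'b ^ 'b) \<noteq> 0"
    by (auto simp: mat_def vec_eq_iff)
  ultimately show ?thesis
    unfolding maximally_mixed_eq using B
    by (intro compatible_normalized[where B = B and c = 1]) (auto simp: hermitian_def)
qed

text \<open>The spectral lemma with \<open>U\<close> as the intertwiner between \<sigma> and
  \<open>rotated \<sigma>\<close>, both tensored with the identity on A.\<close>

lemma intertwines_eigenprojector:
  assumes dec: "eigenspace_decomposition \<sigma> P" and l: "l \<in> eigenvalues \<sigma>" "l \<noteq> 0"
  shows "U ** (mat 1 \<otimes>\<^sub>o P l) = (mat 1 \<otimes>\<^sub>o rotated (P l)) ** U"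
proof (rule intertwines_spectral_component)
  have "hermitian \<sigma>"
    using density by (simp add: density_operator_def)
  note props = eigenprojector_properties[OF this dec]
  have \<sigma>_eq: "\<sigma> = (\<Sum>m\<in>eigenvalues \<sigma>. m *\<^sub>C P m)"
    using dec by (simp add: eigenspace_decomposition_def)
  \<comment> \<open>A sum over an infinite set is 0 by convention, so infinitely many eigenvalues
    would force \<sigma> to be 0, against trace 1.\<close>
  have "\<sigma> \<noteq> 0"
    using density by (auto simp: density_operator_def trace_def)
  then show "finite (eigenvalues \<sigma>)"
    using \<sigma>_eq by (metis sum.infinite)
  show "mat 1 \<otimes>\<^sub>o \<sigma> = (\<Sum>m\<in>eigenvalues \<sigma>. m *\<^sub>C (mat 1 \<otimes>\<^sub>o P m))"
    by (subst \<sigma>_eq) (simp add: tensor_op_sum_right tensor_op_cscale_right)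
  show "mat 1 \<otimes>\<^sub>o rotated \<sigma> = (\<Sum>m\<in>eigenvalues \<sigma>. m *\<^sub>C (mat 1 \<otimes>\<^sub>o rotated (P m)))"
    by (subst \<sigma>_eq) (simp add: rotated_sum rotated_cscale tensor_op_sum_right tensor_op_cscale_right)
  show "(mat 1 \<otimes>\<^sub>o \<sigma>) ** (mat 1 \<otimes>\<^sub>o P m) = m *\<^sub>C (mat 1 \<otimes>\<^sub>o P m)"
    "(mat 1 \<otimes>\<^sub>o rotated (P m)) ** (mat 1 \<otimes>\<^sub>o rotated \<sigma>) = m *\<^sub>C (mat 1 \<otimes>\<^sub>o rotated (P m))"
    if "m \<in> eigenvalues \<sigma>" for m
    using props(4,5)[OF that]
    by (simp_all add: tensor_op_mult rotated_mult rotated_cscale tensor_op_cscale_right)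
qed (use l intertwines_catalyst in auto)

end

theorem proposition2:
  shows "(\<forall>(U :: complex ^ ('a::finite \<times> 'b::finite) ^ ('a \<times> 'b)) \<sigma> P.
            compatible U \<sigma> \<and> eigenspace_decomposition \<sigma> P \<longrightarrow>
            (\<forall>l \<in> eigenvalues \<sigma>. l \<noteq> 0 \<longrightarrow> compatible U (normalized (P l)))) \<and>
         (\<forall>U :: complex ^ ('a \<times> 'b) ^ ('a \<times> 'b).
            (\<exists>\<sigma>. compatible U \<sigma> \<and> invertible \<sigma>) \<longrightarrow> compatible U maximally_mixed)"
proof (intro conjI allI impI ballI)
  fix U :: "complex ^ ('a \<times> 'b) ^ ('a \<times> 'b)" and \<sigma> P l
  assume *: "compatible U \<sigma> \<and> eigenspace_decomposition \<sigma> P" and l: "l \<in> eigenvalues \<sigma>" "l \<noteq> 0"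
  then obtain V where "catalysis U \<sigma> V"
    by (auto simp: compatible_def catalysis_def)
  then interpret catalysis U \<sigma> V .
  have "hermitian \<sigma>"
    using density by (simp add: density_operator_def)
  note props = eigenprojector_properties[OF this conjunct2[OF *] l(1)]
  \<comment> \<open>Here \<open>B\<close> is \<open>P l\<close> itself, and
    \<open>P l ** \<sigma> = l *\<^sub>C P l\<close> gives \<open>c = l\<close>.\<close>
  show "compatible U (normalized (P l))"
    using * l props by (intro compatible_normalized[OF intertwines_eigenprojector[of P]]) auto
next
  fix U :: "complex ^ ('a \<times> 'b) ^ ('a \<times> 'b)"
  assume "\<exists>\<sigma>. compatible U \<sigma> \<and> invertible \<sigma>"
  then obtain \<sigma> V where "catalysis U \<sigma> V" "invertible \<sigma>"
    by (auto simp: compatible_def catalysis_def)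
  then show "compatible U maximally_mixed"
    by (rule catalysis.compatible_maximally_mixed)
qed

end
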